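(* Let $(\mathbb{B},\|\cdot\|)$ be a normed space, let $(x_n)_{n\in\mathbb{N}}$ be a sequence in $\mathbb{B}$ and let $(a_n)$ be real numbers with $0<a_0\le a_1\le\cdots$ and $a_n\to\infty$. For $n\in\mathbb{N}$ and $x\ge 0$ put $s_n:=\sum_{i=0}^n x_i$ and $f(x):=\min\{n\in\mathbb{N}: a_n\ge x\}$. Let $\gamma:\mathbb{Q}^+\to\mathbb{N}$, let $(z_n)$ be a sequence of natural numbers, let $\varepsilon\in\mathbb{Q}^+$ and $w\in\mathbb{N}$, and set $M:=\gamma(\varepsilon/4)$. Suppose that $z_M\ge\|s_i\|$ for all $i\le M$, and that $\|s_n-s_M\|<\varepsilon/4$ for all $n\in[M;w]$. Then, with $$N:=\max\left\{\gamma\left(\tfrac{\varepsilon}{4}\right),\ f\left(\frac{4a_{\gamma(\varepsilon/4)}z_{\gamma(\varepsilon/4)}}{\varepsilon}\right)\right\},$$ we have $\left\|\frac{1}{a_n}\sum_{i=0}^n a_ix_i\right\|<\varepsilon$ for all $n\in[N;w]$.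
   Context: For natural numbers $a,b$, $[a;b]:=\{a,a+1,\dots,b\}$ if $a\le b$ and $\emptyset$ otherwise. *)

theory Defs
  imports Complex_Main
begin

definition partial_sum :: "(nat \<Rightarrow> 'b::real_normed_vector) \<Rightarrow> nat \<Rightarrow> 'b" where
  "partial_sum x n = (\<Sum>i=0..n. x i)"

(* The least index n with a n \<ge> x; it exists for every x as soon as a tends to infinity. *)
definition first_index :: "(nat \<Rightarrow> real) \<Rightarrow> real \<Rightarrow> nat" where
  "first_index a x = (LEAST n. a n \<ge> x)"

definition kronecker_rate ::
    "(nat \<Rightarrow> real) \<Rightarrow> (rat \<Rightarrow> nat) \<Rightarrow> (nat \<Rightarrow> nat) \<Rightarrow> rat \<Rightarrow> nat" where
  "kronecker_rate a \<gamma> z \<epsilon> =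
     max (\<gamma> (\<epsilon> / 4))
         (first_index a (4 * a (\<gamma> (\<epsilon> / 4)) * real (z (\<gamma> (\<epsilon> / 4))) / real_of_rat \<epsilon>))"

end

theory Submission imports Defs
begin

text \<open>
  If the norms of the sums \<open>x\<^sub>m + \<dots> + x\<^sub>k\<close> with \<open>m \<le> k \<le> n\<close> are at most \<open>c\<close>, then summation by
  parts bounds the norm of \<open>a\<^sub>m x\<^sub>m + \<dots> + a\<^sub>n x\<^sub>n\<close> by \<open>(2 a\<^sub>n - a\<^sub>m) c\<close>. Split the weighted sum after
  \<open>M = \<gamma> (\<epsilon> / 4)\<close>. Up to \<open>M\<close> this applies with \<open>c = z\<^sub>M\<close> and gives at most \<open>2 a\<^sub>M z\<^sub>M\<close>, hence at
  most \<open>a\<^sub>n \<epsilon> / 2\<close> by the choice of \<open>f\<close>; beyond \<open>M\<close> it applies with \<open>c = \<epsilon> / 4\<close> and gives less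
  than \<open>a\<^sub>n \<epsilon> / 2\<close>, because the weights are positive.
\<close>

lemma sum_scaleR_by_parts:
  fixes a :: "nat \<Rightarrow> real" and x :: "nat \<Rightarrow> 'b::real_vector"
  assumes "m \<le> n"
  shows "(\<Sum>i=m..n. a i *\<^sub>R x i) =
    a n *\<^sub>R (\<Sum>i=m..n. x i) - (\<Sum>k=m..<n. (a (Suc k) - a k) *\<^sub>R (\<Sum>i=m..k. x i))"
  using assms by (induction rule: dec_induct) (simp_all add: algebra_simps)

lemma norm_sum_scaleR_mono_le:
  fixes a :: "nat \<Rightarrow> real" and x :: "nat \<Rightarrow> 'b::real_normed_vector"
  assumes "mono_on {m..n} a" and "0 \<le> a n" and "m \<le> n"
    and bound: "\<And>k. k \<in> {m..n} \<Longrightarrow> norm (\<Sum>i=m..k. x i) \<le> c"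
  shows "norm (\<Sum>i=m..n. a i *\<^sub>R x i) \<le> (2 * a n - a m) * c"
proof -
  let ?s = "\<lambda>k. \<Sum>i=m..k. x i"
  have last_term: "norm (a n *\<^sub>R ?s n) \<le> a n * c"
    using assms by (simp add: mult_left_mono)
  have "norm (\<Sum>k=m..<n. (a (Suc k) - a k) *\<^sub>R ?s k) \<le> (\<Sum>k=m..<n. (a (Suc k) - a k) * c)"
  proof (rule sum_norm_le)
    fix k assume "k \<in> {m..<n}"
    then show "norm ((a (Suc k) - a k) *\<^sub>R ?s k) \<le> (a (Suc k) - a k) * c"
      using mono_onD[OF \<open>mono_on {m..n} a\<close>, of k "Suc k"] bound[of k]
      by (simp add: mult_left_mono)
  qed
  also have "\<dots> = (a n - a m) * c"
    using \<open>m \<le> n\<close> by (simp add: sum_distrib_right[symmetric] sum_Suc_diff')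
  finally have increments:
    "norm (\<Sum>k=m..<n. (a (Suc k) - a k) *\<^sub>R ?s k) \<le> (a n - a m) * c" .
  have "norm (\<Sum>i=m..n. a i *\<^sub>R x i)
      \<le> norm (a n *\<^sub>R ?s n) + norm (\<Sum>k=m..<n. (a (Suc k) - a k) *\<^sub>R ?s k)"
    unfolding sum_scaleR_by_parts[OF \<open>m \<le> n\<close>] by (rule norm_triangle_ineq4)
  also have "\<dots> \<le> a n * c + (a n - a m) * c"
    using last_term increments by (rule add_mono)
  finally show ?thesis by (simp add: algebra_simps)
qed

lemma norm_sum_scaleR_mono_less:
  fixes a :: "nat \<Rightarrow> real" and x :: "nat \<Rightarrow> 'b::real_normed_vector"
  assumes "mono_on {m..n} a" and "0 < a m" and "0 < a n" and "0 < c"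
    and "\<And>k. k \<in> {m..n} \<Longrightarrow> norm (\<Sum>i=m..k. x i) \<le> c"
  shows "norm (\<Sum>i=m..n. a i *\<^sub>R x i) < 2 * (a n * c)"
proof (cases "m \<le> n")
  case True
  then have "norm (\<Sum>i=m..n. a i *\<^sub>R x i) \<le> (2 * a n - a m) * c"
    using assms by (intro norm_sum_scaleR_mono_le) simp_all
  also have "\<dots> < 2 * (a n * c)"
    using \<open>0 < a m\<close> \<open>0 < c\<close> by (simp add: algebra_simps)
  finally show ?thesis .
next
  case False
  then show ?thesis using \<open>0 < a n\<close> \<open>0 < c\<close> by simp
qed

lemma partial_sum_split:
  assumes "m \<le> n"
  shows "partial_sum x n = partial_sum x m + (\<Sum>i=Suc m..n. x i)"
  using sum.ub_add_nat[of 0 m x "n - m"] assms by (simp add: partial_sum_def)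

lemma norm_sum_scaleR_split_less:
  fixes a :: "nat \<Rightarrow> real" and x :: "nat \<Rightarrow> 'b::real_normed_vector"
  assumes "mono a" and "0 < a 0" and "m \<le> n" and "0 < \<delta>"
    and head_bound: "\<And>k. k \<le> m \<Longrightarrow> norm (partial_sum x k) \<le> C"
    and tail_bound: "\<And>k. k \<in> {m..n} \<Longrightarrow> norm (partial_sum x k - partial_sum x m) \<le> \<delta>"
  shows "norm (\<Sum>i=0..n. a i *\<^sub>R x i) < 2 * (a m * C + a n * \<delta>)"
proof -
  have a_pos: "0 < a k" for k
    using \<open>0 < a 0\<close> monoD[OF \<open>mono a\<close>, of 0 k] by simp
  have mono_on_a: "mono_on A a" for A
    using \<open>mono a\<close> by (rule mono_on_subset) simp
  have "0 \<le> C"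
    using norm_ge_zero head_bound[OF order_refl] by (rule order_trans)
  have "norm (\<Sum>i=0..m. a i *\<^sub>R x i) \<le> (2 * a m - a 0) * C"
    using a_pos[of m] head_bound unfolding partial_sum_def
    by (intro norm_sum_scaleR_mono_le mono_on_a) simp_all
  also have "\<dots> \<le> 2 * (a m * C)"
    using a_pos[of 0] \<open>0 \<le> C\<close> by (simp add: algebra_simps)
  finally have head: "norm (\<Sum>i=0..m. a i *\<^sub>R x i) \<le> 2 * (a m * C)" .
  have "norm (\<Sum>i=Suc m..k. x i) \<le> \<delta>" if "k \<in> {Suc m..n}" for k
    using tail_bound[of k] partial_sum_split[of m k x] that by simp
  then have tail: "norm (\<Sum>i=Suc m..n. a i *\<^sub>R x i) < 2 * (a n * \<delta>)"
    by (intro norm_sum_scaleR_mono_less mono_on_a a_pos \<open>0 < \<delta>\<close>)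
  have "norm (\<Sum>i=0..n. a i *\<^sub>R x i)
      \<le> norm (\<Sum>i=0..m. a i *\<^sub>R x i) + norm (\<Sum>i=Suc m..n. a i *\<^sub>R x i)"
    using partial_sum_split[OF \<open>m \<le> n\<close>, of "\<lambda>i. a i *\<^sub>R x i"]
    by (simp add: partial_sum_def norm_triangle_ineq)
  also have "\<dots> < 2 * (a m * C) + 2 * (a n * \<delta>)"
    using head tail by (rule add_le_less_mono)
  finally show ?thesis by (simp add: distrib_left)
qed

lemma first_index_le_iff:
  assumes "mono a" and "filterlim a at_top sequentially"
  shows "first_index a y \<le> n \<longleftrightarrow> y \<le> a n"
proof
  obtain k where "y \<le> a k"
    using assms(2) by (auto simp: filterlim_at_top eventually_sequentially)
  then have "y \<le> a (first_index a y)"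
    unfolding first_index_def by (rule LeastI)
  also assume "first_index a y \<le> n"
  then have "a (first_index a y) \<le> a n"
    by (rule monoD[OF \<open>mono a\<close>])
  finally show "y \<le> a n" .
next
  assume "y \<le> a n"
  then show "first_index a y \<le> n"
    unfolding first_index_def by (rule Least_le)
qed

theorem theorem3p2:
  fixes x :: "nat \<Rightarrow> 'b::real_normed_vector"
    and a :: "nat \<Rightarrow> real"
    and \<gamma> :: "rat \<Rightarrow> nat"
    and z :: "nat \<Rightarrow> nat"
    and \<epsilon> :: rat
    and w :: nat
  assumes "0 < a 0"
    and "\<forall>n. a n \<le> a (Suc n)"
    and "filterlim a at_top sequentially"
    and "0 < \<epsilon>"
    and "\<forall>i \<le> \<gamma> (\<epsilon> / 4). norm (partial_sum x i) \<le> real (z (\<gamma> (\<epsilon> / 4)))"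
    and "\<forall>n \<in> {\<gamma> (\<epsilon> / 4)..w}.
           norm (partial_sum x n - partial_sum x (\<gamma> (\<epsilon> / 4))) < real_of_rat (\<epsilon> / 4)"
  shows "\<forall>n \<in> {kronecker_rate a \<gamma> z \<epsilon>..w}.
           norm ((1 / a n) *\<^sub>R (\<Sum>i=0..n. a i *\<^sub>R x i)) < real_of_rat \<epsilon>"
proof
  fix n assume n: "n \<in> {kronecker_rate a \<gamma> z \<epsilon>..w}"
  define M e where "M = \<gamma> (\<epsilon> / 4)" and "e = real_of_rat \<epsilon>"
  have "0 < e" using \<open>0 < \<epsilon>\<close> by (simp add: e_def)
  have "mono a" using assms(2) by (simp add: mono_iff_le_Suc)
  then have "0 < a n" using \<open>0 < a 0\<close> monoD[of a 0 n] by simp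
  have "M \<le> n" and "n \<le> w" and "4 * a M * real (z M) / e \<le> a n"
    using n first_index_le_iff[OF \<open>mono a\<close> assms(3)]
    by (simp_all add: kronecker_rate_def M_def e_def)
  then have "a M * real (z M) \<le> a n * (e / 4)"
    using \<open>0 < e\<close> by (simp add: field_simps)
  moreover have "norm (partial_sum x k - partial_sum x M) \<le> e / 4" if "k \<in> {M..n}" for k
    using assms(6) that \<open>n \<le> w\<close> by (simp add: M_def e_def of_rat_divide less_imp_le)
  then have "norm (\<Sum>i=0..n. a i *\<^sub>R x i) < 2 * (a M * real (z M) + a n * (e / 4))"
    using \<open>mono a\<close> \<open>0 < a 0\<close> \<open>M \<le> n\<close> \<open>0 < e\<close> assms(5)
    by (intro norm_sum_scaleR_split_less) (simp_all add: M_def)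
  ultimately have "norm (\<Sum>i=0..n. a i *\<^sub>R x i) < a n * e"
    by (simp add: algebra_simps)
  then show "norm ((1 / a n) *\<^sub>R (\<Sum>i=0..n. a i *\<^sub>R x i)) < real_of_rat \<epsilon>"
    using \<open>0 < a n\<close> by (simp add: e_def field_simps)
qed

end
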